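(* Let $G$ be a connected finite simple graph on $[n]$, let $\mathcal{S}\subset[n]$ be a minimal cut of $G$, and let $V_1,V_2$ be the vertex sets of the two connected components of $G_{[n]\setminus\mathcal{S}}$. Then $$\mathrm{v}_{P_{\mathcal{S}}}(J_G)=\gamma_c(V_1,V_2)=\min\{|A| : A\in\mathcal{D}_c(V_1,V_2)\},$$ where $$\mathcal{D}_c(V_1,V_2)=\{A\subseteq V_1\cup V_2 : A\cap V_i\in\mathcal{D}_c(G_{V_i\cup\mathcal{S}})\ \text{for each } i=1,2\}.$$
   Context: Let $R=\mathbb{C}[x_1,\dots,x_n,y_1,\dots,y_n]$ with the standard grading, and $f_{i,j}=x_iy_j-x_jy_i$. For a simple graph $G$ on $[n]=\{1,\dots,n\}$, the binomial edge ideal is $J_G=(f_{i,j} : \{i,j\}\in E(G),\ i<j)\subset R$. For $W\subseteq[n]$, $G_W$ denotes the induced subgraph on $W$. A vertex $i$ is a cut point of a graph $H$ if $H$ has fewer connected components than the graph obtained from $H$ by deleting $i$. A minimal cut (minimal $2$-cut) of $G$ is a nonempty $\mathcal{S}\subsetneq[n]$ such that $G_{[n]\setminus\mathcal{S}}$ has exactly two connected components and each $i\in\mathcal{S}$ is a cut point of $G_{([n]\setminus\mathcal{S})\cup\{i\}}$. For $\mathcal{S}\subseteq[n]$, let $G_1,\dots,G_c$ be the connected components of $G_{[n]\setminus\mathcal{S}}$ and put $P_{\mathcal{S}}=(x_i,y_i : i\in\mathcal{S})+\sum_{t=1}^{c}(f_{i,j} : i<j,\ i,j\in V(G_t))$.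 This is a prime ideal, and it is a minimal prime of $J_G$ when $\mathcal{S}$ is a minimal cut. For a homogeneous ideal $I$ and $\mathfrak{p}\in\mathrm{Ass}(I)$, $\mathrm{v}_{\mathfrak{p}}(I)=\min\{d\ge0 : \exists f \text{ homogeneous of degree } d \text{ with } (I:f)=\mathfrak{p}\}$. For a connected graph $H$, $\mathcal{D}_c(H)$ is the collection of connected dominating sets of $H$: subsets $B\subseteq V(H)$ such that $H_B$ is connected and every vertex of $V(H)\setminus B$ is adjacent to some vertex of $B$. The number $\gamma_c(V_1,V_2)$ is by definition $\min\{|A| : A\in\mathcal{D}_c(V_1,V_2)\}$. *)

theory Defs
  imports
    Complex_Main
    "HOL-Library.Poly_Mapping"
    "HOL-Library.Set_Algebras"
    "HOL-Library.Extended_Nat"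
begin

section \<open>Simple graphs\<close>

record 'v ugraph =
  verts :: "'v set"
  edges :: "'v set set"

definition simple_graph :: "'v ugraph \<Rightarrow> bool" where
  "simple_graph H \<longleftrightarrow> finite (verts H) \<and> (\<forall>e \<in> edges H. e \<subseteq> verts H \<and> card e = 2)"

definition adjacent :: "'v ugraph \<Rightarrow> 'v \<Rightarrow> 'v \<Rightarrow> bool" where
  "adjacent H u v \<longleftrightarrow> {u, v} \<in> edges H"

definition induced_subgraph :: "'v ugraph \<Rightarrow> 'v set \<Rightarrow> 'v ugraph" where
  "induced_subgraph H W = \<lparr>verts = verts H \<inter> W, edges = {e \<in> edges H. e \<subseteq> W}\<rparr>"

text \<open>Connected components are represented by their vertex sets.\<close>

definition conn_components :: "'v ugraph \<Rightarrow> 'v set set" where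
  "conn_components H =
     verts H // {(u, v). u \<in> verts H \<and> v \<in> verts H \<and> (adjacent H)\<^sup>*\<^sup>* u v}"

text \<open>The graph without vertices does not count as connected.\<close>

definition connected_graph :: "'v ugraph \<Rightarrow> bool" where
  "connected_graph H \<longleftrightarrow>
     verts H \<noteq> {} \<and> (\<forall>u \<in> verts H. \<forall>v \<in> verts H. (adjacent H)\<^sup>*\<^sup>* u v)"

definition cut_point :: "'v ugraph \<Rightarrow> 'v \<Rightarrow> bool" where
  "cut_point H i \<longleftrightarrow> i \<in> verts H \<and>
     card (conn_components H) < card (conn_components (induced_subgraph H (verts H - {i})))"

definition minimal_cut :: "'v ugraph \<Rightarrow> 'v set \<Rightarrow> bool" where
  "minimal_cut G S \<longleftrightarrow> S \<noteq> {} \<and> S \<subset> verts G \<and>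
     card (conn_components (induced_subgraph G (verts G - S))) = 2 \<and>
     (\<forall>i \<in> S. cut_point (induced_subgraph G ((verts G - S) \<union> {i})) i)"

definition conn_dominating_sets :: "'v ugraph \<Rightarrow> 'v set set" where
  "conn_dominating_sets H = {B. B \<subseteq> verts H \<and> connected_graph (induced_subgraph H B) \<and>
     (\<forall>v \<in> verts H - B. \<exists>b \<in> B. adjacent H v b)}"

definition conn_dominating_pairs ::
    "'v ugraph \<Rightarrow> 'v set \<Rightarrow> 'v set \<Rightarrow> 'v set \<Rightarrow> 'v set set" where
  "conn_dominating_pairs G S V1 V2 = {A. A \<subseteq> V1 \<union> V2 \<and>
     A \<inter> V1 \<in> conn_dominating_sets (induced_subgraph G (V1 \<union> S)) \<and>
     A \<inter> V2 \<in> conn_dominating_sets (induced_subgraph G (V2 \<union> S))}"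

definition gamma_c :: "'v ugraph \<Rightarrow> 'v set \<Rightarrow> 'v set \<Rightarrow> 'v set \<Rightarrow> nat" where
  "gamma_c G S V1 V2 = Min (card ` conn_dominating_pairs G S V1 V2)"


section \<open>Polynomials, ideals and the v-number\<close>

text \<open>Multivariate polynomials with coefficients in the complex numbers and variables
  indexed by \<open>'x\<close>: finitely supported functions from monomials (exponent vectors) to
  coefficients, multiplied by convolution.\<close>

type_synonym 'x cpoly = "('x \<Rightarrow>\<^sub>0 nat) \<Rightarrow>\<^sub>0 complex"

definition pvar :: "'x \<Rightarrow> 'x cpoly" where
  "pvar v = Poly_Mapping.single (Poly_Mapping.single v 1) 1"

text \<open>The ideal generated by a set is its span in the ring regarded as a module over itself.\<close>

definition ideal_gen :: "'a::comm_ring_1 set \<Rightarrow> 'a set" where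
  "ideal_gen B = module.span (*) B"

definition ideal_colon :: "'a::comm_ring_1 set \<Rightarrow> 'a \<Rightarrow> 'a set" where
  "ideal_colon I f = {g. g * f \<in> I}"

definition mon_degree :: "('x \<Rightarrow>\<^sub>0 nat) \<Rightarrow> nat" where
  "mon_degree m = (\<Sum>v \<in> Poly_Mapping.keys m. Poly_Mapping.lookup m v)"

definition homogeneous_of_degree :: "nat \<Rightarrow> 'x cpoly \<Rightarrow> bool" where
  "homogeneous_of_degree d f \<longleftrightarrow> (\<forall>m \<in> Poly_Mapping.keys f. mon_degree m = d)"

text \<open>The value is \<open>\<infinity>\<close> exactly when no homogeneous \<open>f\<close> with \<open>(I : f) = p\<close> exists;
  a finite value is an attained minimum.\<close>

definition v_number :: "'x cpoly set \<Rightarrow> 'x cpoly set \<Rightarrow> enat" where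
  "v_number p I = Inf {enat d | d. \<exists>f. homogeneous_of_degree d f \<and> ideal_colon I f = p}"


section \<open>Binomial edge ideals\<close>

text \<open>The index set \<open>[n]\<close> is modelled by a finite linearly ordered type \<open>'v\<close>, so that
  the polynomial ring in the \<open>2 n\<close> variables is the full type \<open>'v xyvar cpoly\<close>.\<close>

datatype 'v xyvar = X 'v | Y 'v

definition fbinom :: "'v \<Rightarrow> 'v \<Rightarrow> 'v xyvar cpoly" where
  "fbinom i j = pvar (X i) * pvar (Y j) - pvar (X j) * pvar (Y i)"

definition binomial_edge_ideal :: "('v::{finite,linorder}) ugraph \<Rightarrow> 'v xyvar cpoly set" where
  "binomial_edge_ideal G = ideal_gen {fbinom i j | i j. {i, j} \<in> edges G \<and> i < j}"

text \<open>The sums below are sums of ideals, that is, elementwise sums of sets.\<close>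

definition cut_ideal :: "('v::{finite,linorder}) ugraph \<Rightarrow> 'v set \<Rightarrow> 'v xyvar cpoly set" where
  "cut_ideal G S =
     ideal_gen ((\<lambda>i. pvar (X i)) ` S \<union> (\<lambda>i. pvar (Y i)) ` S) +
     (\<Sum>C \<in> conn_components (induced_subgraph G (verts G - S)).
        ideal_gen {fbinom i j | i j. i < j \<and> i \<in> C \<and> j \<in> C})"

end

theory Submission
  imports Defs
begin

text \<open>
  For a vertex set \<open>W\<close> let \<open>Q\<^sub>W\<close> be the kernel of the Segre-type map that kills \<open>x\<^sub>v, y\<^sub>v\<close> for
  \<open>v \<notin> W\<close> and sends \<open>x\<^sub>v \<mapsto> t\<^sub>v\<close>, \<open>y\<^sub>v \<mapsto> t\<^sub>v w\<^sub>C\<close> for \<open>v\<close> in the component \<open>C\<close> of \<open>G\<^sub>W\<close>. It is a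
  prime containing \<open>J\<^sub>G\<close>, and \<open>P\<^sub>S = Q\<^sub>W\<close> for \<open>W = [n] - S\<close>.

  Upper bound: for \<open>A \<in> \<D>\<^sub>c(V\<^sub>1, V\<^sub>2)\<close>, \<open>i \<in> A \<inter> V\<^sub>1\<close> and \<open>j \<in> A \<inter> V\<^sub>2\<close>, the polynomial
  \<open>g = f\<^sub>i\<^sub>j \<Prod>a\<in>A - {i, j}. x\<^sub>a\<close> satisfies \<open>(J\<^sub>G : g) = P\<^sub>S\<close>, because \<open>f\<^sub>u\<^sub>v\<close> times one variable
  for each interior vertex of a path from \<open>u\<close> to \<open>v\<close> lies in \<open>J\<^sub>G\<close>.

  Lower bound: let \<open>(J\<^sub>G : f) = P\<^sub>S\<close>. Then \<open>f \<notin> P\<^sub>S\<close>, since otherwise \<open>g \<in> (J\<^sub>G : f)\<close>. With the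
  \<open>\<nat>\<^sup>n\<close>-grading \<open>deg x\<^sub>v = deg y\<^sub>v = e\<^sub>v\<close>, some graded component \<open>f\<^sub>a\<close> is not in \<open>P\<^sub>S\<close>; let \<open>A\<close> be the
  support of \<open>a\<close>. For every \<open>W \<supseteq> A\<close> with \<open>P\<^sub>S \<not>\<subseteq> Q\<^sub>W\<close> we get \<open>f\<^sub>a \<in> Q\<^sub>W\<close>, so some component of \<open>G\<^sub>W\<close> must
  join two vertices of \<open>A\<close> on different sides of the cut. Taking \<open>W = A\<close>, \<open>W = A \<union> {v}\<close> and
  \<open>W = A \<union> {s}\<close> with \<open>s \<in> S\<close> shows that \<open>A\<close> belongs to \<open>\<D>\<^sub>c(V\<^sub>1, V\<^sub>2)\<close>.
\<close>

section \<open>Ideals and finitely supported functions\<close>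

abbreviation lookup where "lookup \<equiv> Poly_Mapping.lookup"
abbreviation keys where "keys \<equiv> Poly_Mapping.keys"
abbreviation single where "single \<equiv> Poly_Mapping.single"

lemma poly_mapping_eq_sum_single: "f = (\<Sum>m\<in>keys f. single m (lookup f m))"
proof (rule poly_mapping_eqI)
  fix k
  show "lookup f k = lookup (\<Sum>m\<in>keys f. single m (lookup f m)) k"
    by (simp add: lookup_sum lookup_single when_def sum.delta in_keys_iff)
qed

lemma single_eq_0_iff: "single k a = 0 \<longleftrightarrow> a = 0"
  by (metis lookup_single_eq lookup_zero single_zero)

lemma sum_keys_eq_sum_superset:
  assumes "finite B" "keys f \<subseteq> B" "\<And>m. T m 0 = 0"
  shows "(\<Sum>m\<in>keys f. T m (lookup f m)) = (\<Sum>m\<in>B. T m (lookup f m))"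
  using assms by (intro sum.mono_neutral_left) (auto simp: in_keys_iff)

text \<open>Values \<open>T\<close> on single terms extend to polynomials by summing over
  \<open>keys\<close>. Since \<open>T m 0 = 0\<close>, all sums may be taken over one common finite
  index set.\<close>

lemma linear_extension_add:
  assumes "\<And>m. T m 0 = 0" "\<And>m a b. T m (a + b) = T m a + T m b"
  shows "(\<Sum>m\<in>keys (f + g). T m (lookup (f + g) m)) =
    (\<Sum>m\<in>keys f. T m (lookup f m)) + (\<Sum>m\<in>keys g. T m (lookup g m) :: 'b::comm_monoid_add)"
proof -
  let ?B = "keys f \<union> keys g"
  have "keys (f + g) \<subseteq> ?B" by (rule keys_add)
  then show ?thesis
    using sum_keys_eq_sum_superset[of ?B "f + g" T] sum_keys_eq_sum_superset[of ?B f T]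
      sum_keys_eq_sum_superset[of ?B g T] assms
    by (simp add: lookup_add sum.distrib)
qed

lemma linear_extension_sum:
  assumes "\<And>m. T m 0 = 0" "\<And>m a b. T m (a + b) = T m a + T m b" "finite I"
  shows "(\<Sum>m\<in>keys (sum F I). T m (lookup (sum F I) m)) =
    (\<Sum>i\<in>I. \<Sum>m\<in>keys (F i). T m (lookup (F i) m) :: 'b::comm_monoid_add)"
  using assms(3)
  by (induction I rule: finite_induct) (simp_all add: linear_extension_add assms(1,2))

text \<open>Expanding both factors into terms reduces the claim to single terms, where it is
  \<open>Tmult\<close>.\<close>

lemma linear_extension_mult:
  fixes T :: "'m::comm_monoid_add \<Rightarrow> 'a::comm_ring_1 \<Rightarrow> 'b::comm_ring_1"
  assumes T0: "\<And>m. T m 0 = 0" and Tadd: "\<And>m a b. T m (a + b) = T m a + T m b"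
    and Tmult: "\<And>m m' a b. T (m + m') (a * b) = T m a * T m' b"
  shows "(\<Sum>m\<in>keys (f * g). T m (lookup (f * g) m)) =
    (\<Sum>m\<in>keys f. T m (lookup f m)) * (\<Sum>m\<in>keys g. T m (lookup g m))"
proof -
  define E where "E = (\<lambda>f. \<Sum>m\<in>keys f. T m (lookup f m))"
  have E_single: "E (single m a) = T m a" for m a
    by (cases "a = 0") (simp_all add: E_def T0)
  have E_sum: "E (sum F I) = (\<Sum>i\<in>I. E (F i))" if "finite I" for F I
    unfolding E_def by (rule linear_extension_sum[OF T0 Tadd that])
  have "f * g = (\<Sum>m\<in>keys f. single m (lookup f m)) * (\<Sum>m\<in>keys g. single m (lookup g m))"
    using poly_mapping_eq_sum_single[of f] poly_mapping_eq_sum_single[of g] by simp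
  also have "\<dots> = (\<Sum>m\<in>keys f. \<Sum>m'\<in>keys g. single (m + m') (lookup f m * lookup g m'))"
    by (simp add: sum_product mult_single)
  finally have "E (f * g) = (\<Sum>m\<in>keys f. \<Sum>m'\<in>keys g. T m (lookup f m) * T m' (lookup g m'))"
    by (simp add: E_sum E_single Tmult)
  then show ?thesis by (simp add: E_def sum_product)
qed

lemma module_mult: "module ((*) :: 'a::comm_ring_1 \<Rightarrow> 'a \<Rightarrow> 'a)"
  by unfold_locales (simp_all add: algebra_simps)

definition is_ideal :: "'a::comm_ring_1 set \<Rightarrow> bool" where
  "is_ideal I \<longleftrightarrow> module.subspace (*) I"

lemma is_idealI:
  assumes "0 \<in> I" "\<And>a b. a \<in> I \<Longrightarrow> b \<in> I \<Longrightarrow> a + b \<in> I" "\<And>r a. a \<in> I \<Longrightarrow> r * a \<in> I"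
  shows "is_ideal I"
  using assms by (simp add: is_ideal_def module.subspace_def[OF module_mult])

lemma is_ideal_ideal_gen: "is_ideal (ideal_gen B)"
  by (simp add: is_ideal_def ideal_gen_def module.subspace_span[OF module_mult])

lemma ideal_gen_base: "b \<in> B \<Longrightarrow> b \<in> ideal_gen B"
  by (simp add: ideal_gen_def module.span_base[OF module_mult])

lemma ideal_gen_subset: "is_ideal I \<Longrightarrow> B \<subseteq> I \<Longrightarrow> ideal_gen B \<subseteq> I"
  by (simp add: is_ideal_def ideal_gen_def module.span_minimal[OF module_mult])

lemma ideal_gen_Un: "ideal_gen (B \<union> C) = ideal_gen B + ideal_gen C"
  by (auto simp: ideal_gen_def module.span_Un[OF module_mult] set_plus_def)

lemma ideal_zero: "is_ideal I \<Longrightarrow> 0 \<in> I"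
  and ideal_add: "is_ideal I \<Longrightarrow> a \<in> I \<Longrightarrow> b \<in> I \<Longrightarrow> a + b \<in> I"
  and ideal_mult: "is_ideal I \<Longrightarrow> a \<in> I \<Longrightarrow> r * a \<in> I"
  by (simp_all add: is_ideal_def module.subspace_def[OF module_mult])

lemma ideal_uminus: "is_ideal I \<Longrightarrow> a \<in> I \<Longrightarrow> - a \<in> I"
  using ideal_mult[of I a "-1"] by simp

lemma ideal_diff: "is_ideal I \<Longrightarrow> a \<in> I \<Longrightarrow> b \<in> I \<Longrightarrow> a - b \<in> I"
  using ideal_add[of I a "- b"] ideal_uminus[of I b] by simp

lemma ideal_sum: "is_ideal I \<Longrightarrow> (\<And>k. k \<in> K \<Longrightarrow> F k \<in> I) \<Longrightarrow> sum F K \<in> I"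
  by (induction K rule: infinite_finite_induct) (auto intro: ideal_zero ideal_add)

lemma is_ideal_colon: "is_ideal I \<Longrightarrow> is_ideal (ideal_colon I f)"
  by (rule is_idealI) (auto simp: ideal_colon_def distrib_right mult.assoc
      intro: ideal_zero ideal_add ideal_mult)

section \<open>Kernels of Segre maps\<close>

text \<open>\<open>xdeg m\<close> and \<open>ydeg c m\<close> are the exponents of the variables \<open>t\<close> and \<open>w\<close> in the image of the
  monomial \<open>m\<close> under \<open>x\<^sub>v \<mapsto> t\<^sub>v\<close>, \<open>y\<^sub>v \<mapsto> t\<^sub>v w\<^bsub>c v\<^esub>\<close>. Nesting the two polynomial rings in the target
  of \<open>segre\<close> makes it an integral domain by the library's type class instances.\<close>

definition xdeg :: "('v::finite xyvar \<Rightarrow>\<^sub>0 nat) \<Rightarrow> 'v \<Rightarrow>\<^sub>0 nat" where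
  "xdeg m = (\<Sum>v\<in>UNIV. single v (lookup m (X v) + lookup m (Y v)))"

definition ydeg :: "('v \<Rightarrow> 'v) \<Rightarrow> ('v::finite xyvar \<Rightarrow>\<^sub>0 nat) \<Rightarrow> 'v \<Rightarrow>\<^sub>0 nat" where
  "ydeg c m = (\<Sum>v\<in>UNIV. single (c v) (lookup m (Y v)))"

lemma lookup_xdeg: "lookup (xdeg m) v = lookup m (X v) + lookup m (Y v)"
  by (simp add: xdeg_def lookup_sum lookup_single when_def sum.delta')

lemma lookup_ydeg: "lookup (ydeg c m) r = (\<Sum>v | c v = r. lookup m (Y v))"
  by (simp add: ydeg_def lookup_sum lookup_single when_def sum.If_cases)

lemma xdeg_add: "xdeg (m + m') = xdeg m + xdeg m'"
  by (rule poly_mapping_eqI) (simp add: lookup_xdeg lookup_add)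

lemma ydeg_add: "ydeg c (m + m') = ydeg c m + ydeg c m'"
  by (simp add: ydeg_def lookup_add single_add sum.distrib)

text \<open>The outer exponent belongs to the variables \<open>t\<close>, the inner one to
  \<open>w\<close>. The test on \<open>keys (xdeg m)\<close> kills the monomials that contain a
  variable of a vertex outside \<open>W\<close>.\<close>

definition seg_term :: "'v set \<Rightarrow> ('v \<Rightarrow> 'v) \<Rightarrow> ('v::finite xyvar \<Rightarrow>\<^sub>0 nat) \<Rightarrow> complex \<Rightarrow>
    (('v \<Rightarrow>\<^sub>0 nat) \<Rightarrow>\<^sub>0 'v cpoly)" where
  "seg_term W c m a = (if keys (xdeg m) \<subseteq> W then single (xdeg m) (single (ydeg c m) a) else 0)"

definition segre :: "'v set \<Rightarrow> ('v \<Rightarrow> 'v) \<Rightarrow> ('v::finite xyvar) cpoly \<Rightarrow>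
    (('v \<Rightarrow>\<^sub>0 nat) \<Rightarrow>\<^sub>0 'v cpoly)" where
  "segre W c f = (\<Sum>m\<in>keys f. seg_term W c m (lookup f m))"

text \<open>Natural exponents cannot cancel, so a product of monomials survives the truncation to
  \<open>W\<close> iff both factors do.\<close>

lemma keys_add_nat: "keys (a + b :: 'k \<Rightarrow>\<^sub>0 nat) = keys a \<union> keys b"
  by (auto simp: in_keys_iff lookup_add)

lemma seg_term_0: "seg_term W c m 0 = 0"
  and seg_term_add: "seg_term W c m (a + b) = seg_term W c m a + seg_term W c m b"
  and seg_term_mult: "seg_term W c (m + m') (a * b) = seg_term W c m a * seg_term W c m' b"
  by (auto simp: seg_term_def single_add xdeg_add ydeg_add keys_add_nat mult_single)

lemma segre_add: "segre W c (f + g) = segre W c f + segre W c g"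
  unfolding segre_def by (rule linear_extension_add[OF seg_term_0 seg_term_add])

lemma segre_mult: "segre W c (f * g) = segre W c f * segre W c g"
  unfolding segre_def by (rule linear_extension_mult[OF seg_term_0 seg_term_add seg_term_mult])

lemma segre_0 [simp]: "segre W c 0 = 0"
  by (simp add: segre_def)

lemma segre_diff: "segre W c (f - g) = segre W c f - segre W c g"
  using segre_add[of W c "f - g" g] by simp

lemma segre_single: "segre W c (single m a) = seg_term W c m a"
  by (cases "a = 0") (simp_all add: segre_def seg_term_0)

definition segre_ideal :: "'v set \<Rightarrow> ('v \<Rightarrow> 'v) \<Rightarrow> ('v::finite xyvar) cpoly set" where
  "segre_ideal W c = {f. segre W c f = 0}"

lemma is_ideal_segre_ideal: "is_ideal (segre_ideal W c)"
  by (rule is_idealI) (simp_all add: segre_ideal_def segre_add segre_mult)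

text \<open>The target of \<open>segre\<close> is an integral domain; the sort
  \<open>linorder\<close> gives access to the instance.\<close>

lemma segre_ideal_prime:
  fixes f g :: "('v::{finite,linorder} xyvar) cpoly"
  shows "f * g \<in> segre_ideal W c \<longleftrightarrow> f \<in> segre_ideal W c \<or> g \<in> segre_ideal W c"
  by (simp add: segre_ideal_def segre_mult)

lemma one_notin_segre_ideal: "1 \<notin> segre_ideal (W :: 'v::finite set) c"
proof -
  have "xdeg (0 :: 'v xyvar \<Rightarrow>\<^sub>0 nat) = 0" by (simp add: xdeg_def)
  then have "segre W c 1 = single 0 (single (ydeg c 0) 1)"
    using segre_single[of W c 0 1] by (simp add: seg_term_def)
  then show ?thesis by (simp add: segre_ideal_def single_eq_0_iff)
qed

lemma xdeg_single: "xdeg (single (X v) k) = single v k" "xdeg (single (Y v) k) = single v k"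
  by (auto intro!: poly_mapping_eqI simp: lookup_xdeg lookup_single when_def)

lemma ydeg_single: "ydeg c (single (X v) k) = 0" "ydeg c (single (Y v) k) = single (c v) k"
  by (simp_all add: ydeg_def lookup_single when_def if_distrib[of "single _"] sum.delta cong: if_cong)

lemma segre_X: "segre W c (pvar (X v)) = (if v \<in> W then single (single v 1) 1 else 0)"
  by (simp add: pvar_def segre_single seg_term_def xdeg_single ydeg_single)

lemma segre_Y: "segre W c (pvar (Y v)) = (if v \<in> W then single (single v 1) (pvar (c v)) else 0)"
  by (simp add: pvar_def segre_single seg_term_def xdeg_single ydeg_single)

lemma pvar_X_in_segre_ideal: "pvar (X v) \<in> segre_ideal W c \<longleftrightarrow> v \<notin> W"
  by (simp add: segre_ideal_def segre_X single_eq_0_iff)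

lemma pvar_Y_in_segre_ideal: "v \<notin> W \<Longrightarrow> pvar (Y v) \<in> segre_ideal W c"
  by (simp add: segre_ideal_def segre_Y)

lemma pvar_eq_iff: "pvar r = pvar s \<longleftrightarrow> r = s"
proof
  assume "pvar r = pvar s"
  then have "keys (pvar r) = keys (pvar s)" by simp
  then have "keys (single r (1::nat)) = keys (single s (1::nat))" by (simp add: pvar_def)
  then show "r = s" by simp
qed simp

text \<open>If both vertices lie in \<open>W\<close>, the two terms have the same
  \<open>t\<close>-monomial, so only the variables \<open>pvar (c i)\<close> and
  \<open>pvar (c j)\<close> can tell them apart.\<close>

lemma fbinom_in_segre_ideal:
  "fbinom i j \<in> segre_ideal W c \<longleftrightarrow> i \<notin> W \<or> j \<notin> W \<or> c i = c j"
proof (cases "i \<in> W \<and> j \<in> W")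
  case True
  then have "segre W c (fbinom i j) =
      single (single i 1 + single j 1) (pvar (c j)) - single (single i 1 + single j 1) (pvar (c i))"
    by (simp add: fbinom_def segre_diff segre_mult segre_X segre_Y mult_single add.commute)
  then have "fbinom i j \<in> segre_ideal W c \<longleftrightarrow> pvar (c j) = pvar (c i)"
    by (simp add: segre_ideal_def single_diff[symmetric] single_eq_0_iff)
  then show ?thesis using True by (auto simp: pvar_eq_iff)
qed (auto simp: segre_ideal_def fbinom_def segre_diff segre_mult segre_X segre_Y)

lemma lookup_segre:
  "lookup (lookup (segre W c f) a) b =
    (if keys a \<subseteq> W then \<Sum>m | m \<in> keys f \<and> xdeg m = a \<and> ydeg c m = b. lookup f m else 0)"
proof -
  have "lookup (lookup (segre W c f) a) b =
      (\<Sum>m\<in>keys f. if keys a \<subseteq> W \<and> xdeg m = a \<and> ydeg c m = b then lookup f m else 0)"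
    unfolding segre_def lookup_sum
    by (intro sum.cong refl) (auto simp: seg_term_def lookup_single when_def)
  also have "\<dots> = (if keys a \<subseteq> W then \<Sum>m | m \<in> keys f \<and> xdeg m = a \<and> ydeg c m = b. lookup f m else 0)"
    by (simp add: sum.inter_filter)
  finally show ?thesis .
qed

text \<open>Kernel membership splits into scalar equations, one for each target monomial. Those with
  fixed \<open>a\<close> are the conditions on the graded component of multidegree
  \<open>a\<close>.\<close>

lemma segre_ideal_iff:
  "f \<in> segre_ideal W c \<longleftrightarrow>
    (\<forall>a b. keys a \<subseteq> W \<longrightarrow> (\<Sum>m | m \<in> keys f \<and> xdeg m = a \<and> ydeg c m = b. lookup f m) = 0)"
proof -
  have "f \<in> segre_ideal W c \<longleftrightarrow> (\<forall>a b. lookup (lookup (segre W c f) a) b = 0)"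
    by (auto simp: segre_ideal_def intro!: poly_mapping_eqI)
  then show ?thesis by (auto simp: lookup_segre)
qed

lemma sum_over_fibers:
  fixes c :: "'a::finite \<Rightarrow> 'b::finite" and h :: "'a \<Rightarrow> 'd::comm_monoid_add"
  shows "(\<Sum>r | \<delta> r = s. \<Sum>v | c v = r. h v) = (\<Sum>v | \<delta> (c v) = s. h v)"
proof -
  have "(\<Sum>v | \<delta> (c v) = s. h v) = (\<Sum>r\<in>{r. \<delta> r = s}. sum h {v \<in> {v. \<delta> (c v) = s}. c v = r})"
    by (rule sum.group[symmetric]) auto
  also have "\<dots> = (\<Sum>r | \<delta> r = s. \<Sum>v | c v = r. h v)"
    by (intro sum.cong) auto
  finally show ?thesis by simp
qed
text \<open>On \<open>keys a\<close> the labelling \<open>d\<close> factors through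
  \<open>c\<close>, so \<open>ydeg d\<close> arises from \<open>ydeg c\<close> by adding up
  exponents.\<close>

lemma ydeg_determined_by_finer:
  assumes "xdeg m = a" "xdeg m' = a" and ref: "\<And>u v. u \<in> keys a \<Longrightarrow> v \<in> keys a \<Longrightarrow> c u = c v \<Longrightarrow> d u = d v"
    and "ydeg c m = ydeg c m'"
  shows "ydeg d m = ydeg d m'"
proof -
  \<comment> \<open>The map through which \<open>d\<close> factors. Its value at labels not taken on
    \<open>keys a\<close> is arbitrary, which is harmless because all \<open>Y\<close>-exponents
    vanish off \<open>keys a\<close>.\<close>
  define \<delta> where "\<delta> r = d (SOME v. v \<in> keys a \<and> c v = r)" for r
  have \<delta>: "\<delta> (c v) = d v" if "v \<in> keys a" for v
  proof -
    have "(SOME u. u \<in> keys a \<and> c u = c v) \<in> keys a \<and> c (SOME u. u \<in> keys a \<and> c u = c v) = c v"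
      using that by (intro someI[of "\<lambda>u. u \<in> keys a \<and> c u = c v"]) simp
    then show ?thesis unfolding \<delta>_def using ref that by blast
  qed
  have "lookup (ydeg d n) s = (\<Sum>r | \<delta> r = s. lookup (ydeg c n) r)" if "xdeg n = a" for n s
  proof -
    have zero: "lookup n (Y v) = 0" if "v \<notin> keys a" for v
      using that \<open>xdeg n = a\<close> by (auto simp: in_keys_iff lookup_xdeg)
    have "(\<Sum>v | d v = s. lookup n (Y v)) = (\<Sum>v | v \<in> keys a \<and> d v = s. lookup n (Y v))"
      by (rule sum.mono_neutral_right[OF finite]) (use zero in blast)+
    moreover have "(\<Sum>v | \<delta> (c v) = s. lookup n (Y v)) = (\<Sum>v | v \<in> keys a \<and> d v = s. lookup n (Y v))"
    proof (rule sum.mono_neutral_right)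
      show "{v. v \<in> keys a \<and> d v = s} \<subseteq> {v. \<delta> (c v) = s}"
        by (auto simp: \<delta>)
      show "\<forall>v\<in>{v. \<delta> (c v) = s} - {v. v \<in> keys a \<and> d v = s}. lookup n (Y v) = 0"
      proof
        fix v assume "v \<in> {v. \<delta> (c v) = s} - {v. v \<in> keys a \<and> d v = s}"
        then have "v \<notin> keys a" by (auto simp: \<delta>)
        then show "lookup n (Y v) = 0" by (rule zero)
      qed
    qed (rule finite)
    ultimately show ?thesis
      unfolding lookup_ydeg by (simp only: sum_over_fibers)
  qed
  then show ?thesis using assms(1,2,4) by (intro poly_mapping_eqI) simp
qed

text \<open>A fibre of \<open>ydeg d\<close> is a disjoint union of fibres of \<open>ydeg c\<close>,
  each with coefficient sum zero. In the lower bound \<open>c\<close> labels the components of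
  \<open>G\<^sub>W\<close> and \<open>d\<close> the sides of the cut.\<close>

lemma fiber_sum_zero_of_finer:
  assumes "f \<in> segre_ideal W c" "keys a \<subseteq> W"
    and "\<And>u v. u \<in> keys a \<Longrightarrow> v \<in> keys a \<Longrightarrow> c u = c v \<Longrightarrow> d u = d v"
  shows "(\<Sum>m | m \<in> keys f \<and> xdeg m = a \<and> ydeg d m = b. lookup f m) = 0"
proof -
  let ?F = "{m. m \<in> keys f \<and> xdeg m = a \<and> ydeg d m = b}"
  have fin: "finite ?F" by simp
  have "sum (lookup f) ?F = (\<Sum>b'\<in>ydeg c ` ?F. sum (lookup f) {m \<in> ?F. ydeg c m = b'})"
    by (rule sum.image_gen[OF fin])
  also have "\<dots> = 0"
  proof (rule sum.neutral, rule ballI)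
    fix b' assume "b' \<in> ydeg c ` ?F"
    then obtain m0 where m0: "xdeg m0 = a" "ydeg d m0 = b" "ydeg c m0 = b'" by auto
    have "ydeg d m = b" if "xdeg m = a" "ydeg c m = b'" for m
    proof -
      have "ydeg d m = ydeg d m0"
        by (rule ydeg_determined_by_finer[of m a m0 c d])
          (use that m0 in simp | erule (2) assms(3))+
      then show ?thesis using m0 by simp
    qed
    then have "{m \<in> ?F. ydeg c m = b'} = {m. m \<in> keys f \<and> xdeg m = a \<and> ydeg c m = b'}"
      by blast
    then show "sum (lookup f) {m \<in> ?F. ydeg c m = b'} = 0"
      using assms(1,2) by (simp add: segre_ideal_iff)
  qed
  finally show ?thesis .
qed

section \<open>Generators of the Segre kernel\<close>

lemma single_sum: "finite B \<Longrightarrow> single k (sum F B) = (\<Sum>b\<in>B. single k (F b))"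
  by (induction B rule: finite_induct) (simp_all add: single_add)

lemma monomial_split:
  assumes "k \<le> lookup m z"
  shows "m = (m - single z k) + single z (k::nat)"
  using assms by (intro poly_mapping_eqI) (auto simp: lookup_add lookup_minus lookup_single when_def)

lemma pvar_times_single: "pvar z * single m a = single (m + single z 1) a"
  by (simp add: pvar_def mult_single add.commute)

lemma monomial_in_ideal_of_var:
  assumes "is_ideal P" "pvar z \<in> P" "lookup m z > 0"
  shows "single m a \<in> P"
proof -
  have "single m a = single (m - single z 1) a * pvar z"
    using monomial_split[of 1 m z] assms(3) pvar_times_single[of z "m - single z 1" a]
    by (simp add: mult.commute)
  then show ?thesis using assms(1,2) ideal_mult by metis
qed

text \<open>Each exchange of \<open>x\<^sub>v y\<^sub>w\<close> for \<open>x\<^sub>w y\<^sub>v\<close> moves \<open>m\<close> strictly closer to \<open>m'\<close>.\<close>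

lemma same_segre_term_congruent:
  fixes m m' :: "'v::finite xyvar \<Rightarrow>\<^sub>0 nat"
  assumes P: "is_ideal P" and gen: "\<And>u v. u \<in> W \<Longrightarrow> v \<in> W \<Longrightarrow> c u = c v \<Longrightarrow> fbinom u v \<in> P"
    and "keys (xdeg m) \<subseteq> W" "xdeg m = xdeg m'" "ydeg c m = ydeg c m'"
  shows "single m a - single m' a \<in> P"
  using assms(3-)
\<comment> \<open>Subtraction is truncated: the measure counts only surpluses of
  \<open>X\<close>-exponents of \<open>m\<close> over \<open>m'\<close>.\<close>
proof (induction "\<Sum>v\<in>UNIV. lookup m (X v) - lookup m' (X v)" arbitrary: m rule: less_induct)
  case (less m)
  have x: "lookup m (X v) + lookup m (Y v) = lookup m' (X v) + lookup m' (Y v)" for v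
    using less.prems(2) by (metis lookup_xdeg)
  have y: "(\<Sum>v | c v = r. lookup m (Y v)) = (\<Sum>v | c v = r. lookup m' (Y v))" for r
    using less.prems(3) by (metis lookup_ydeg)
  show ?case
  proof (cases "\<forall>v. lookup m (X v) = lookup m' (X v)")
    case True
    have "m = m'"
    proof (rule poly_mapping_eqI)
      fix z show "lookup m z = lookup m' z" using True x by (cases z) (simp, metis add_left_cancel)
    qed
    then show ?thesis using P by (simp add: ideal_zero)
  next
    case False
    then obtain v0 where v0: "lookup m (X v0) \<noteq> lookup m' (X v0)" by auto
    \<comment> \<open>The sums over a label class agree, so a deficit at \<open>v\<close> forces a
      surplus elsewhere in the class.\<close>
    have swap: "\<exists>w. c w = c v \<and> lookup n (Y w) > lookup n' (Y w)"
      if "lookup n (Y v) < lookup n' (Y v)"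
        "(\<Sum>u | c u = c v. lookup n (Y u)) = (\<Sum>u | c u = c v. lookup n' (Y u))" for v and n n' :: "'v xyvar \<Rightarrow>\<^sub>0 nat"
    proof (rule ccontr)
      assume "\<not> ?thesis"
      then have "(\<Sum>u | c u = c v. lookup n (Y u)) < (\<Sum>u | c u = c v. lookup n' (Y u))"
        using that(1) by (intro sum_strict_mono_ex1) (auto simp: not_less)
      then show False using that(2) by simp
    qed
    obtain v w where vw: "c v = c w" "lookup m (X v) > lookup m' (X v)" "lookup m (Y w) > lookup m' (Y w)"
    proof (cases "lookup m (X v0) > lookup m' (X v0)")
      case True
      then have "lookup m (Y v0) < lookup m' (Y v0)" using x[of v0] by linarith
      from swap[OF this y] True that show thesis by metis
    next
      \<comment> \<open>Here \<open>v0\<close> takes the role of \<open>w\<close>, and its partner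
        comes from \<open>swap\<close> with \<open>m\<close> and \<open>m'\<close>
        interchanged.\<close>
      case False
      then have *: "lookup m (Y v0) > lookup m' (Y v0)" using x[of v0] v0 by linarith
      from swap[OF this y[symmetric]] obtain w where "c w = c v0" "lookup m (Y w) < lookup m' (Y w)" by auto
      with x[of w] have "lookup m (X w) > lookup m' (X w)" by linarith
      with that[OF \<open>c w = c v0\<close> _ *] show thesis .
    qed
    have xw: "lookup m (X w) < lookup m' (X w)" using vw x[of w] by linarith
    then have neq: "v \<noteq> w" using vw by auto
    define n where "n = m - single (X v) 1 - single (Y w) 1"
    have m: "m = n + single (Y w) 1 + single (X v) 1"
      using vw neq unfolding n_def
      by (intro poly_mapping_eqI) (auto simp: lookup_add lookup_minus lookup_single when_def)
    define m1 where "m1 = n + single (Y v) 1 + single (X w) 1"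
    have xm1: "xdeg m1 = xdeg m" by (simp add: m m1_def xdeg_add xdeg_single ac_simps)
    have ym1: "ydeg c m1 = ydeg c m" by (simp add: m m1_def ydeg_add ydeg_single vw(1))
    \<comment> \<open>The surplus at \<open>v\<close> drops by one. At \<open>w\<close> there is a
      deficit by \<open>xw\<close>, so one more \<open>X w\<close> creates no surplus.\<close>
    have lt: "(\<Sum>v\<in>UNIV. lookup m1 (X v) - lookup m' (X v)) < (\<Sum>v\<in>UNIV. lookup m (X v) - lookup m' (X v))"
    proof (rule sum_strict_mono_ex1)
      show "\<forall>u\<in>UNIV. lookup m1 (X u) - lookup m' (X u) \<le> lookup m (X u) - lookup m' (X u)"
        using xw by (auto simp: m m1_def lookup_add lookup_single when_def)
      have "lookup m1 (X v) - lookup m' (X v) < lookup m (X v) - lookup m' (X v)"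
        using vw(2) neq by (simp add: m m1_def lookup_add lookup_single when_def)
      then show "\<exists>u\<in>UNIV. lookup m1 (X u) - lookup m' (X u) < lookup m (X u) - lookup m' (X u)" by blast
    qed simp
    have IH: "single m1 a - single m' a \<in> P"
      using less.hyps[OF lt] less.prems xm1 ym1 by simp
    have "v \<in> W" "w \<in> W"
      using less.prems(1) vw(2,3) by (auto simp: subset_iff in_keys_iff lookup_xdeg)
    then have "single n a * fbinom v w \<in> P" using P gen vw(1) by (simp add: ideal_mult)
    moreover have "single n a * fbinom v w = single m a - single m1 a"
      by (simp add: fbinom_def pvar_def right_diff_distrib mult_single m m1_def ac_simps)
    ultimately show ?thesis using ideal_add[OF P _ IH, of "single m a - single m1 a"] by simp
  qed
qed

text \<open>Modulo \<open>P\<close>, monomials leaving \<open>W\<close> vanish and the others may be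
  replaced by one representative of their fibre. The coefficients collected there sum to
  zero.\<close>

lemma segre_ideal_subset:
  fixes P :: "'v::finite xyvar cpoly set"
  assumes P: "is_ideal P"
    and var: "\<And>v. v \<notin> W \<Longrightarrow> pvar (X v) \<in> P" "\<And>v. v \<notin> W \<Longrightarrow> pvar (Y v) \<in> P"
    and gen: "\<And>u v. u \<in> W \<Longrightarrow> v \<in> W \<Longrightarrow> c u = c v \<Longrightarrow> fbinom u v \<in> P"
  shows "segre_ideal W c \<subseteq> P"
proof
  fix f assume f: "f \<in> segre_ideal W c"
  let ?K = "{m \<in> keys f. keys (xdeg m) \<subseteq> W}"
  define \<psi> where "\<psi> m = (xdeg m, ydeg c m)" for m :: "'v xyvar \<Rightarrow>\<^sub>0 nat"
  \<comment> \<open>An arbitrary monomial of each fibre; it need not occur in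
    \<open>f\<close>.\<close>
  define \<rho> where "\<rho> k = (SOME m. \<psi> m = k)" for k
  have \<rho>: "\<psi> (\<rho> (\<psi> m)) = \<psi> m" for m
    unfolding \<rho>_def by (rule someI) (rule refl)
  have "f = (\<Sum>m\<in>keys f. single m (lookup f m))" by (rule poly_mapping_eq_sum_single)
  also have "\<dots> = (\<Sum>m\<in>keys f - ?K. single m (lookup f m)) + (\<Sum>m\<in>?K. single m (lookup f m))"
    by (rule sum.subset_diff) auto
  also have "(\<Sum>m\<in>?K. single m (lookup f m)) =
      (\<Sum>m\<in>?K. single m (lookup f m) - single (\<rho> (\<psi> m)) (lookup f m)) +
      (\<Sum>m\<in>?K. single (\<rho> (\<psi> m)) (lookup f m))"
    by (simp add: sum_subtractf)
  also have "(\<Sum>m\<in>?K. single (\<rho> (\<psi> m)) (lookup f m)) = 0"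
  proof -
    have "(\<Sum>m\<in>?K. single (\<rho> (\<psi> m)) (lookup f m)) =
        (\<Sum>k\<in>\<psi> ` ?K. \<Sum>m | m \<in> ?K \<and> \<psi> m = k. single (\<rho> (\<psi> m)) (lookup f m))"
      by (rule sum.image_gen) simp
    also have "\<dots> = (\<Sum>k\<in>\<psi> ` ?K. single (\<rho> k) (\<Sum>m | m \<in> ?K \<and> \<psi> m = k. lookup f m))"
    proof (intro sum.cong refl)
      fix k
      have "single (\<rho> k) (\<Sum>m | m \<in> ?K \<and> \<psi> m = k. lookup f m) =
          (\<Sum>m | m \<in> ?K \<and> \<psi> m = k. single (\<rho> k) (lookup f m))"
        by (rule single_sum) simp
      then show "(\<Sum>m | m \<in> ?K \<and> \<psi> m = k. single (\<rho> (\<psi> m)) (lookup f m)) =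
          single (\<rho> k) (\<Sum>m | m \<in> ?K \<and> \<psi> m = k. lookup f m)" by simp
    qed
    also have "\<dots> = 0"
    proof (rule sum.neutral, rule ballI)
      fix k assume "k \<in> \<psi> ` ?K"
      then obtain a b where k: "k = (a, b)" "keys a \<subseteq> W" by (auto simp: \<psi>_def)
      then have "{m. m \<in> ?K \<and> \<psi> m = k} = {m. m \<in> keys f \<and> xdeg m = a \<and> ydeg c m = b}"
        by (auto simp: \<psi>_def)
      then have "(\<Sum>m | m \<in> ?K \<and> \<psi> m = k. lookup f m) = 0"
        using f k(2) by (simp add: segre_ideal_iff)
      then show "single (\<rho> k) (\<Sum>m | m \<in> ?K \<and> \<psi> m = k. lookup f m) = 0" by simp
    qed
    finally show ?thesis .
  qed
  finally have f_eq: "f = (\<Sum>m\<in>keys f - ?K. single m (lookup f m)) +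
      ((\<Sum>m\<in>?K. single m (lookup f m) - single (\<rho> (\<psi> m)) (lookup f m)) + 0)" .
  have "single m (lookup f m) \<in> P" if "m \<in> keys f - ?K" for m
  proof -
    obtain v where "v \<in> keys (xdeg m)" "v \<notin> W" using \<open>m \<in> keys f - ?K\<close> by auto
    then have "lookup m (X v) > 0 \<or> lookup m (Y v) > 0" by (auto simp: in_keys_iff lookup_xdeg)
    then show ?thesis using monomial_in_ideal_of_var[OF P] var \<open>v \<notin> W\<close> by blast
  qed
  then have 1: "(\<Sum>m\<in>keys f - ?K. single m (lookup f m)) \<in> P"
    by (rule ideal_sum[OF P])
  have "single m (lookup f m) - single (\<rho> (\<psi> m)) (lookup f m) \<in> P" if "m \<in> ?K" for m
    using that \<rho>[of m] by (intro same_segre_term_congruent[OF P gen]) (auto simp: \<psi>_def)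
  then have "(\<Sum>m\<in>?K. single m (lookup f m) - single (\<rho> (\<psi> m)) (lookup f m)) \<in> P"
    by (rule ideal_sum[OF P])
  from ideal_add[OF P 1 ideal_add[OF P this ideal_zero[OF P]]] show "f \<in> P"
    by (rule ssubst[OF f_eq])
qed

section \<open>Components and walks\<close>

abbreviation reach :: "'v ugraph \<Rightarrow> 'v set \<Rightarrow> 'v \<Rightarrow> 'v \<Rightarrow> bool" where
  "reach G W \<equiv> (adjacent (induced_subgraph G W))\<^sup>*\<^sup>*"

lemma adjacent_induced: "adjacent (induced_subgraph G W) u v \<longleftrightarrow> adjacent G u v \<and> u \<in> W \<and> v \<in> W"
  by (auto simp: adjacent_def induced_subgraph_def)

lemma verts_induced: "verts (induced_subgraph G W) = verts G \<inter> W"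
  by (simp add: induced_subgraph_def)

lemma induced_induced: "induced_subgraph (induced_subgraph G W) B = induced_subgraph G (W \<inter> B)"
  by (auto simp: induced_subgraph_def)

lemma adjacent_sym: "adjacent G u v \<Longrightarrow> adjacent G v u"
  by (simp add: adjacent_def insert_commute)

lemma reach_sym: "reach G W u v \<Longrightarrow> reach G W v u"
  by (metis adjacent_sym sympD sympI symp_rtranclp)

lemma reach_mono: "W \<subseteq> W' \<Longrightarrow> reach G W u v \<Longrightarrow> reach G W' u v"
  by (erule rtranclp_mono[THEN predicate2D, rotated]) (auto simp: adjacent_induced)

text \<open>Vertices of one component have equal predicates \<open>reach G W v\<close>, hence the
  same choice. The label is a vertex so that it can index a variable \<open>w\<close>.\<close>

definition comp_label :: "'v ugraph \<Rightarrow> 'v set \<Rightarrow> 'v \<Rightarrow> 'v" where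
  "comp_label G W v = (SOME w. reach G W v w)"

lemma comp_label_eq_iff: "comp_label G W u = comp_label G W v \<longleftrightarrow> reach G W u v"
proof
  have "reach G W w (comp_label G W w)" for w
    unfolding comp_label_def by (rule someI[of _ w]) simp
  then show "reach G W u v" if "comp_label G W u = comp_label G W v"
    using that by (metis reach_sym rtranclp_trans)
  assume "reach G W u v"
  then have "reach G W u = reach G W v"
    by (intro ext) (metis reach_sym rtranclp_trans)
  then show "comp_label G W u = comp_label G W v" by (simp add: comp_label_def)
qed

section \<open>Component ideals and the edge ideal\<close>

abbreviation comp_ideal :: "'v ugraph \<Rightarrow> 'v set \<Rightarrow> 'v::finite xyvar cpoly set" where
  "comp_ideal G W \<equiv> segre_ideal W (comp_label G W)"

lemma fbinom_in_comp_ideal: "fbinom u v \<in> comp_ideal G W \<longleftrightarrow> u \<notin> W \<or> v \<notin> W \<or> reach G W u v"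
  by (simp add: fbinom_in_segre_ideal comp_label_eq_iff)

lemma is_ideal_edge_ideal: "is_ideal (binomial_edge_ideal G)"
  by (simp add: binomial_edge_ideal_def is_ideal_ideal_gen)

text \<open>An edge inside \<open>W\<close> stays in one component of \<open>G\<^sub>W\<close>; any
  other edge has an end whose variables are killed.\<close>

lemma edge_ideal_subset_comp_ideal: "binomial_edge_ideal G \<subseteq> comp_ideal G W"
  unfolding binomial_edge_ideal_def
proof (rule ideal_gen_subset[OF is_ideal_segre_ideal], clarify)
  fix i j assume "{i, j} \<in> edges G"
  then have "i \<in> W \<Longrightarrow> j \<in> W \<Longrightarrow> reach G W i j"
    by (intro r_into_rtranclp) (simp add: adjacent_def induced_subgraph_def)
  then show "fbinom i j \<in> comp_ideal G W" by (auto simp: fbinom_in_comp_ideal)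
qed

lemma fbinom_swap: "fbinom j i = - fbinom i j"
  by (simp add: fbinom_def)

lemma fbinom_same: "fbinom i i = 0"
  by (simp add: fbinom_def)

text \<open>The generators are listed for ordered pairs only; antisymmetry lifts the
  restriction.\<close>

lemma fbinom_in_ideal_of_ordered:
  fixes u v :: "'v::linorder"
  assumes "is_ideal I" "u < v \<Longrightarrow> fbinom u v \<in> I" "v < u \<Longrightarrow> fbinom v u \<in> I"
  shows "fbinom u v \<in> I"
  using assms ideal_uminus[OF assms(1), of "fbinom v u"] ideal_zero[OF assms(1)]
  by (cases u v rule: linorder_cases) (auto simp: fbinom_same fbinom_swap[of u v])

lemma fbinom_edge_in_edge_ideal:
  assumes "adjacent G u v"
  shows "fbinom u v \<in> binomial_edge_ideal G"
proof -
  have "fbinom i j \<in> binomial_edge_ideal G" if "adjacent G i j" "i < j" for i j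
    unfolding binomial_edge_ideal_def using that
    by (intro ideal_gen_base) (auto simp: adjacent_def)
  then show ?thesis
    using fbinom_in_ideal_of_ordered[OF is_ideal_edge_ideal] assms adjacent_sym[OF assms] by blast
qed

text \<open>\<open>via E B u v\<close>: some walk from \<open>u\<close> to \<open>v\<close> with at least one edge has all its interior
  vertices in \<open>B\<close>.\<close>

definition via :: "('v \<Rightarrow> 'v \<Rightarrow> bool) \<Rightarrow> 'v set \<Rightarrow> 'v \<Rightarrow> 'v \<Rightarrow> bool" where
  "via E B u v \<longleftrightarrow> (\<exists>w. (\<lambda>x y. E x y \<and> y \<in> B)\<^sup>*\<^sup>* u w \<and> E w v)"

lemma via_step:
  assumes "E u w" "w \<in> B" "via E B w v"
  shows "via E B u v"
proof -
  obtain w' where "(\<lambda>x y. E x y \<and> y \<in> B)\<^sup>*\<^sup>* w w'" "E w' v"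
    using assms(3) by (auto simp: via_def)
  then show ?thesis
    using converse_rtranclp_into_rtranclp[of "\<lambda>x y. E x y \<and> y \<in> B" u w w'] assms(1,2)
    by (auto simp: via_def)
qed

lemma via_edge: "E u v \<Longrightarrow> via E B u v"
  unfolding via_def by blast

lemma via_rtranclp:
  assumes "(\<lambda>x y. E x y \<and> y \<in> B)\<^sup>*\<^sup>* u b" "via E B b v"
  shows "via E B u v"
  using assms(2) rtranclp_trans[OF assms(1)] by (auto simp: via_def)

lemma via_trans:
  assumes "via E B u b" "b \<in> B" "via E B b v"
  shows "via E B u v"
proof -
  obtain w where w: "(\<lambda>x y. E x y \<and> y \<in> B)\<^sup>*\<^sup>* u w" "E w b"
    using assms(1) by (auto simp: via_def)
  then show ?thesis using via_rtranclp via_step assms(2,3) by metis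
qed

lemma via_mono:
  assumes "B \<subseteq> B'" "via E B u v"
  shows "via E B' u v"
proof -
  have "(\<lambda>x y. E x y \<and> y \<in> B) \<le> (\<lambda>x y. E x y \<and> y \<in> B')" using assms(1) by auto
  from rtranclp_mono[OF this] show ?thesis using assms(2) by (auto simp: via_def)
qed

text \<open>The recursion step of the Floyd-Warshall algorithm.\<close>

lemma via_insert:
  assumes "via E (insert b B) u v"
  shows "via E B u v \<or> via E B u b \<and> via E B b v"
proof -
  obtain w where "(\<lambda>x y. E x y \<and> y \<in> insert b B)\<^sup>*\<^sup>* u w" "E w v"
    using assms by (auto simp: via_def)
  then show ?thesis
  proof (induction rule: converse_rtranclp_induct)
    case base
    then show ?case by (simp add: via_edge)
  next
    case (step u u')
    then show ?case using via_edge[of E u b B] via_step[of E u u' B] by auto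
  qed
qed

text \<open>The walk can be cut to start at its last visit to \<open>u\<close> and stop at the next
  visit to \<open>v\<close>.\<close>

lemma via_remove_ends: "via E (insert u (insert v B)) u v \<Longrightarrow> via E B u v"
  by (meson via_insert)

text \<open>Induction on \<open>B\<close> along \<open>via_insert\<close>, using \<open>x\<^sub>b
  f\<^sub>u\<^sub>v = x\<^sub>v f\<^sub>u\<^sub>b + x\<^sub>u f\<^sub>b\<^sub>v\<close> and its
  analogue for \<open>y\<close>. The choice \<open>\<zeta>\<close> allows either variable at each
  vertex, and vertices off the walk are mere extra factors.\<close>

lemma prod_interior_fbinom_in_ideal:
  assumes I: "is_ideal I" and E: "\<And>u v. E u v \<Longrightarrow> fbinom u v \<in> I"
    and "finite B" "\<And>b. b \<in> B \<Longrightarrow> \<zeta> b = X b \<or> \<zeta> b = Y b" "via E B u v"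
  shows "(\<Prod>b\<in>B. pvar (\<zeta> b)) * fbinom u v \<in> I"
  using assms(3-)
proof (induction B arbitrary: u v rule: finite_induct)
  case empty
  then show ?case using E by (auto simp: via_def elim: converse_rtranclpE)
next
  case (insert b B)
  let ?p = "\<Prod>b\<in>B. pvar (\<zeta> b)"
  consider "via E B u v" | "via E B u b" "via E B b v"
    using via_insert[OF insert.prems(2)] by blast
  then show ?case
  proof cases
    case 1
    then have "?p * fbinom u v \<in> I" using insert by simp
    then have "pvar (\<zeta> b) * (?p * fbinom u v) \<in> I" using I by (simp add: ideal_mult)
    then show ?thesis using insert by (simp add: mult.assoc)
  next
    case 2
    then have ub: "?p * fbinom u b \<in> I" and bv: "?p * fbinom b v \<in> I" using insert by simp_all
    have "\<exists>z z'. pvar (\<zeta> b) * fbinom u v = z * fbinom u b + z' * fbinom b v"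
    proof (cases "\<zeta> b = X b")
      case True
      then have "pvar (\<zeta> b) * fbinom u v = pvar (X v) * fbinom u b + pvar (X u) * fbinom b v"
        by (simp add: fbinom_def algebra_simps)
      then show ?thesis by blast
    next
      case False
      then have "\<zeta> b = Y b" using insert.prems(1) by blast
      then have "pvar (\<zeta> b) * fbinom u v = pvar (Y v) * fbinom u b + pvar (Y u) * fbinom b v"
        by (simp add: fbinom_def algebra_simps)
      then show ?thesis by blast
    qed
    then obtain z z' where zz': "pvar (\<zeta> b) * fbinom u v = z * fbinom u b + z' * fbinom b v" by blast
    have "(\<Prod>b\<in>insert b B. pvar (\<zeta> b)) * fbinom u v = ?p * (pvar (\<zeta> b) * fbinom u v)"
      using insert.hyps by (simp add: mult.assoc mult.left_commute)
    also have "\<dots> = z * (?p * fbinom u b) + z' * (?p * fbinom b v)"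
      by (simp only: zz' distrib_left mult.left_commute)
    finally have "(\<Prod>b\<in>insert b B. pvar (\<zeta> b)) * fbinom u v =
      z * (?p * fbinom u b) + z' * (?p * fbinom b v)" .
    then show ?thesis using I ub bv by (simp add: ideal_add ideal_mult)
  qed
qed

section \<open>Degrees\<close>

lemma homogeneous_mult:
  assumes "homogeneous_of_degree d f" "homogeneous_of_degree e g"
  shows "homogeneous_of_degree (d + e) (f * g)"
proof -
  have "mon_degree (m + m') = mon_degree m + mon_degree m'" for m m' :: "'x \<Rightarrow>\<^sub>0 nat"
    unfolding mon_degree_def by (rule setsum_keys_plus_distrib) simp_all
  then show ?thesis
    using assms keys_mult[of f g] unfolding homogeneous_of_degree_def by fastforce
qed

lemma homogeneous_pvar: "homogeneous_of_degree 1 (pvar z)"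
  by (simp add: homogeneous_of_degree_def pvar_def mon_degree_def)

lemma homogeneous_prod_pvar: "homogeneous_of_degree (card B) (\<Prod>b\<in>B. pvar (\<zeta> b))"
proof (induction B rule: infinite_finite_induct)
  case (insert b B)
  then show ?case using homogeneous_mult[OF homogeneous_pvar] by simp
qed (simp_all add: homogeneous_of_degree_def mon_degree_def)

lemma homogeneous_fbinom: "homogeneous_of_degree 2 (fbinom i j)"
proof -
  have "homogeneous_of_degree 2 (pvar z * pvar z')" for z z' :: "'v xyvar"
    using homogeneous_mult[OF homogeneous_pvar homogeneous_pvar] by (simp add: numeral_2_eq_2)
  then show ?thesis
    using keys_diff[of "pvar (X i) * pvar (Y j)" "pvar (X j) * pvar (Y i)"]
    unfolding homogeneous_of_degree_def fbinom_def by blast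
qed

text \<open>Each vertex of the support contributes at least one variable. This bounds the size of
  the dominating set by the degree of \<open>f\<close>.\<close>

lemma card_keys_xdeg_le: "card (keys (xdeg m)) \<le> mon_degree m"
proof -
  let ?K = "keys (xdeg m)"
  have K: "v \<in> ?K \<longleftrightarrow> lookup m (X v) \<noteq> 0 \<or> lookup m (Y v) \<noteq> 0" for v
    by (auto simp: in_keys_iff lookup_xdeg)
  have sub: "keys m \<subseteq> X ` ?K \<union> Y ` ?K"
  proof
    fix z assume "z \<in> keys m"
    then show "z \<in> X ` ?K \<union> Y ` ?K" by (cases z) (simp_all add: in_keys_iff image_iff lookup_xdeg)
  qed
  have "card ?K = (\<Sum>v\<in>?K. 1)" by simp
  also have "\<dots> \<le> (\<Sum>v\<in>?K. lookup m (X v) + lookup m (Y v))"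
    by (rule sum_mono) (auto simp: K Suc_le_eq)
  also have "\<dots> = sum (lookup m) (X ` ?K) + sum (lookup m) (Y ` ?K)"
    by (simp add: sum.distrib sum.reindex inj_on_def)
  also have "\<dots> = sum (lookup m) (X ` ?K \<union> Y ` ?K)"
    by (rule sum.union_disjoint[symmetric]) auto
  also have "\<dots> = mon_degree m"
    unfolding mon_degree_def using sub by (intro sum.mono_neutral_right) (auto simp: in_keys_iff)
  finally show ?thesis .
qed

section \<open>Minimal cuts\<close>

text \<open>The assumptions are symmetric in the two sides, so one-sided results transfer by
  \<open>swap\<close>. The cut point condition enters as \<open>nbr1\<close> and
  \<open>nbr2\<close>.\<close>

locale two_sided_cut =
  fixes G :: "('v::{finite,linorder}) ugraph" and S V1 V2 :: "'v set"
  assumes simple: "simple_graph G" and verts: "verts G = UNIV"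
    and S_nonempty: "S \<noteq> {}" and sides: "V1 \<union> V2 = - S" and disjoint: "V1 \<inter> V2 = {}"
    and conn1: "\<And>u v. u \<in> V1 \<Longrightarrow> v \<in> V1 \<Longrightarrow> reach G (- S) u v"
    and conn2: "\<And>u v. u \<in> V2 \<Longrightarrow> v \<in> V2 \<Longrightarrow> reach G (- S) u v"
    and no_edge: "\<And>u v. u \<in> V1 \<Longrightarrow> v \<in> V2 \<Longrightarrow> \<not> adjacent G u v"
    and nbr1: "\<And>s. s \<in> S \<Longrightarrow> \<exists>v\<in>V1. adjacent G s v"
    and nbr2: "\<And>s. s \<in> S \<Longrightarrow> \<exists>v\<in>V2. adjacent G s v"
begin

lemma swap: "two_sided_cut G S V2 V1"
proof
  show "V2 \<union> V1 = - S" "V2 \<inter> V1 = {}" using sides disjoint by auto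
  show "\<not> adjacent G u v" if "u \<in> V2" "v \<in> V1" for u v
    using that no_edge[of v u] adjacent_sym[of G u v] by auto
qed (fact simple verts S_nonempty | erule (1) conn2 | erule (1) conn1 | erule nbr2 | erule nbr1)+

lemma adjacent_neq: "adjacent G u v \<Longrightarrow> u \<noteq> v"
  using simple by (auto simp: adjacent_def simple_graph_def)

lemma reach_stays:
  assumes "reach G W u v" "u \<in> V1" "W \<subseteq> - S"
  shows "v \<in> V1 \<and> reach G (W \<inter> V1) u v"
  using assms(1)
proof (induction rule: rtranclp_induct)
  case base
  then show ?case using assms(2) by simp
next
  case (step v w)
  then have "adjacent G v w" "v \<in> W" "w \<in> W" by (auto simp: adjacent_induced)
  moreover have "w \<in> V1" using calculation step.IH no_edge sides assms(3) by blast
  ultimately show ?case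
    using step.IH by (auto simp: adjacent_induced intro: rtranclp.rtrancl_into_rtrancl)
qed

lemma reach_iff:
  assumes "u \<in> - S" "v \<in> - S"
  shows "reach G (- S) u v \<longleftrightarrow> (u \<in> V1 \<longleftrightarrow> v \<in> V1)"
proof
  assume r: "reach G (- S) u v"
  show "u \<in> V1 \<longleftrightarrow> v \<in> V1"
    using reach_stays[OF r _ order.refl] reach_stays[OF reach_sym[OF r] _ order.refl] by auto
next
  assume "u \<in> V1 \<longleftrightarrow> v \<in> V1"
  then have "u \<in> V1 \<and> v \<in> V1 \<or> u \<in> V2 \<and> v \<in> V2" using assms sides by auto
  then show "reach G (- S) u v" using conn1[of u v] conn2[of u v] by auto
qed

definition cut_gens :: "'v xyvar cpoly set" where
  "cut_gens = ((\<lambda>i. pvar (X i)) ` S \<union> (\<lambda>i. pvar (Y i)) ` S) \<union>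
    ({fbinom i j | i j. i < j \<and> i \<in> V1 \<and> j \<in> V1} \<union> {fbinom i j | i j. i < j \<and> i \<in> V2 \<and> j \<in> V2})"

text \<open>Identifies \<open>P\<^sub>S\<close> with the kernel \<open>Q\<^sub>W\<close> for
  \<open>W = - S\<close>, which makes its primality available.\<close>

lemma ideal_gen_cut_gens: "ideal_gen cut_gens = comp_ideal G (- S)"
proof
  show "ideal_gen cut_gens \<subseteq> comp_ideal G (- S)"
  proof (rule ideal_gen_subset[OF is_ideal_segre_ideal])
    show "cut_gens \<subseteq> comp_ideal G (- S)"
      using conn1 conn2
      by (auto simp: cut_gens_def fbinom_in_comp_ideal pvar_X_in_segre_ideal pvar_Y_in_segre_ideal)
  qed
  show "comp_ideal G (- S) \<subseteq> ideal_gen cut_gens"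
  proof (rule segre_ideal_subset[OF is_ideal_ideal_gen])
    fix u v assume uv: "u \<in> - S" "v \<in> - S" "comp_label G (- S) u = comp_label G (- S) v"
    then have side: "u \<in> V1 \<and> v \<in> V1 \<or> u \<in> V2 \<and> v \<in> V2"
      using reach_iff sides by (auto simp: comp_label_eq_iff)
    have "fbinom i j \<in> ideal_gen cut_gens" if "i < j" "i \<in> V1 \<and> j \<in> V1 \<or> i \<in> V2 \<and> j \<in> V2" for i j
      using that by (intro ideal_gen_base) (auto simp: cut_gens_def)
    then show "fbinom u v \<in> ideal_gen cut_gens"
      using fbinom_in_ideal_of_ordered[OF is_ideal_ideal_gen] side by blast
  qed (auto simp: cut_gens_def intro: ideal_gen_base)
qed

lemma conn_dominating_iff:
  assumes "B \<subseteq> V1"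
  shows "B \<in> conn_dominating_sets (induced_subgraph G (V1 \<union> S)) \<longleftrightarrow>
    B \<noteq> {} \<and> (\<forall>u\<in>B. \<forall>v\<in>B. reach G B u v) \<and> (\<forall>v\<in>V1 \<union> S - B. \<exists>b\<in>B. adjacent G v b)"
proof -
  have "(V1 \<union> S) \<inter> B = B" using assms by blast
  then show ?thesis
    using assms
    by (auto simp: conn_dominating_sets_def connected_graph_def verts verts_induced induced_induced
        adjacent_induced subset_iff Ball_def)
qed

text \<open>Domination attaches \<open>k\<close> and \<open>l\<close> to \<open>B\<close>, and
  connectedness of \<open>B\<close> joins the attaching vertices.\<close>

lemma via_dominating:
  assumes B: "B \<subseteq> V1" "B \<in> conn_dominating_sets (induced_subgraph G (V1 \<union> S))"
    and kl: "k \<in> V1 \<union> S" "l \<in> V1 \<union> S" "k \<noteq> l"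
  shows "via (adjacent G) B k l"
proof -
  let ?E = "\<lambda>x y. adjacent G x y \<and> y \<in> B"
  have B': "\<And>u v. u \<in> B \<Longrightarrow> v \<in> B \<Longrightarrow> reach G B u v"
      "\<And>v. v \<in> V1 \<union> S - B \<Longrightarrow> \<exists>b\<in>B. adjacent G v b"
    using B conn_dominating_iff by blast+
  have reach_E: "?E\<^sup>*\<^sup>* u v" if "reach G B u v" for u v
    by (rule rtranclp_mono[THEN predicate2D, OF _ that]) (auto simp: adjacent_induced)
  obtain k' where k': "k' \<in> B" "?E\<^sup>*\<^sup>* k k'"
    using B'(2)[of k] kl(1) by (cases "k \<in> B") auto
  obtain l' where l': "l' \<in> B" "l' = l \<or> adjacent G l' l"
    using B'(2)[of l] kl(2) adjacent_sym[of G] by (cases "l \<in> B") auto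
  have kl': "?E\<^sup>*\<^sup>* k l'" using k' reach_E[OF B'(1)[OF k'(1) l'(1)]] by auto
  from l'(2) show ?thesis
  proof
    \<comment> \<open>The walk already ends at \<open>l\<close>. Since \<open>k\<close> differs from
      \<open>l\<close> it has a last edge, as \<open>via\<close> demands.\<close>
    assume "l' = l"
    with kl' kl(3) show ?thesis
      by (auto simp: via_def elim: rtranclp.cases)
  qed (use kl' in \<open>auto simp: via_def\<close>)
qed

section \<open>Upper bound: the witness polynomial\<close>

definition witness :: "'v set \<Rightarrow> 'v \<Rightarrow> 'v \<Rightarrow> 'v xyvar cpoly" where
  "witness A i j = fbinom i j * (\<Prod>a\<in>A - {i, j}. pvar (X a))"

text \<open>Each of the two terms of \<open>fbinom i j\<close> has a variable at \<open>i\<close>.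
  With the factors \<open>x\<^sub>a\<close> it supplies one variable for every vertex of
  \<open>A \<inter> V1\<close>, and these vertices carry a walk from \<open>k\<close> to
  \<open>l\<close>.\<close>

lemma side_binomial_times_witness:
  assumes A: "A \<subseteq> - S" and dom: "A \<inter> V1 \<in> conn_dominating_sets (induced_subgraph G (V1 \<union> S))"
    and ij: "i \<in> A \<inter> V1" "j \<in> A \<inter> V2" and kl: "k \<in> V1" "l \<in> V1"
  shows "fbinom k l * witness A i j \<in> binomial_edge_ideal G"
proof (cases "k = l")
  case True
  then show ?thesis by (simp add: fbinom_same ideal_zero[OF is_ideal_edge_ideal])
next
  case False
  let ?J = "binomial_edge_ideal G"
  let ?p = "\<Prod>a\<in>A \<inter> V1 - {i}. pvar (X a)" and ?q = "\<Prod>a\<in>A \<inter> V2 - {j}. pvar (X a)"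
  have via: "via (adjacent G) (A \<inter> V1) k l"
    using via_dominating[OF _ dom] kl False by simp
  have p: "pvar z * ?p * fbinom k l \<in> ?J" if "z = X i \<or> z = Y i" for z
  proof -
    \<comment> \<open>The update of \<open>X\<close> selects the variable \<open>z\<close> at
      \<open>i\<close> and the \<open>x\<close>-variable elsewhere.\<close>
    have "(\<Prod>b\<in>A \<inter> V1. pvar ((X(i := z)) b)) * fbinom k l \<in> ?J"
      by (rule prod_interior_fbinom_in_ideal[OF is_ideal_edge_ideal fbinom_edge_in_edge_ideal _ _ via])
        (use that in auto)
    also have "(\<Prod>b\<in>A \<inter> V1. pvar ((X(i := z)) b)) = pvar z * ?p"
      using ij(1) by (simp add: prod.remove[of _ i])
    finally show ?thesis .
  qed
  have "A - {i, j} = (A \<inter> V1 - {i}) \<union> (A \<inter> V2 - {j})"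
    using A sides disjoint ij by blast
  then have "(\<Prod>a\<in>A - {i, j}. pvar (X a)) = ?p * ?q"
    using disjoint by (simp add: prod.union_disjoint Int_Diff_disjoint disjoint_iff)
  then have "fbinom k l * witness A i j = (pvar (Y j) * ?q) * (pvar (X i) * ?p * fbinom k l) -
      (pvar (X j) * ?q) * (pvar (Y i) * ?p * fbinom k l)"
    by (simp add: witness_def fbinom_def[of i j] algebra_simps)
  then show ?thesis
    using p by (simp add: ideal_diff[OF is_ideal_edge_ideal] ideal_mult[OF is_ideal_edge_ideal])
qed

text \<open>Walks from \<open>i\<close> to \<open>s\<close> through \<open>A \<inter> V1\<close> and
  from \<open>s\<close> to \<open>j\<close> through \<open>A \<inter> V2\<close> combine into one
  whose interior lies in \<open>A\<close> and \<open>s\<close>; the factor \<open>pvar z\<close>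
  pays for \<open>s\<close>.\<close>

lemma cut_variable_times_witness:
  assumes A: "A \<in> conn_dominating_pairs G S V1 V2"
    and ij: "i \<in> A \<inter> V1" "j \<in> A \<inter> V2" and s: "s \<in> S" and z: "z = X s \<or> z = Y s"
  shows "pvar z * witness A i j \<in> binomial_edge_ideal G"
proof -
  interpret sw: two_sided_cut G S V2 V1 by (rule swap)
  let ?E = "adjacent G"
  have A': "A \<subseteq> V1 \<union> V2" "A \<inter> V1 \<in> conn_dominating_sets (induced_subgraph G (V1 \<union> S))"
      "A \<inter> V2 \<in> conn_dominating_sets (induced_subgraph G (V2 \<union> S))"
    using A by (auto simp: conn_dominating_pairs_def)
  then have sA: "s \<notin> A" using s sides by auto
  have "via ?E (A \<inter> V1) i s" using via_dominating[OF _ A'(2), of i s] ij s sA by auto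
  moreover have "via ?E (A \<inter> V2) s j" using sw.via_dominating[OF _ A'(3), of s j] ij s sA by auto
  ultimately have "via ?E (insert s A) i j"
    by (intro via_trans[of _ _ i s j]) (auto elim!: via_mono[rotated])
  moreover have "insert s A = insert i (insert j (insert s (A - {i, j})))" using ij by auto
  ultimately have via: "via ?E (insert s (A - {i, j})) i j" by (metis via_remove_ends)
  have "(\<Prod>b\<in>insert s (A - {i, j}). pvar ((X(s := z)) b)) * fbinom i j \<in> binomial_edge_ideal G"
    by (rule prod_interior_fbinom_in_ideal[OF is_ideal_edge_ideal fbinom_edge_in_edge_ideal _ _ via])
      (use z in auto)
  also have "(\<Prod>b\<in>insert s (A - {i, j}). pvar ((X(s := z)) b)) = pvar z * (\<Prod>a\<in>A - {i, j}. pvar (X a))"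
  proof -
    have "(\<Prod>b\<in>A - {i, j}. pvar ((X(s := z)) b)) = (\<Prod>a\<in>A - {i, j}. pvar (X a))"
      using sA by (intro prod.cong) auto
    then show ?thesis using sA by (simp del: fun_upd_apply) simp
  qed
  finally show ?thesis by (simp add: witness_def ac_simps)
qed

text \<open>The colon ideal is an ideal, so it suffices to test the generators of
  \<open>P\<^sub>S\<close>. The opposite inclusion follows later from
  \<open>g \<notin> P\<^sub>S\<close> and primality.\<close>

lemma ex_witness:
  assumes A: "A \<in> conn_dominating_pairs G S V1 V2"
  obtains g where "homogeneous_of_degree (card A) g" "g \<notin> comp_ideal G (- S)"
    "\<And>p. p \<in> comp_ideal G (- S) \<Longrightarrow> p * g \<in> binomial_edge_ideal G"
proof -
  interpret sw: two_sided_cut G S V2 V1 by (rule swap)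
  have A': "A \<subseteq> - S" "A \<inter> V1 \<in> conn_dominating_sets (induced_subgraph G (V1 \<union> S))"
      "A \<inter> V2 \<in> conn_dominating_sets (induced_subgraph G (V2 \<union> S))"
    using A sides by (auto simp: conn_dominating_pairs_def)
  obtain i j where ij: "i \<in> A \<inter> V1" "j \<in> A \<inter> V2"
    using A'(2,3) conn_dominating_iff[of "A \<inter> V1"] sw.conn_dominating_iff[of "A \<inter> V2"] by blast
  then have "i \<noteq> j" "\<not> reach G (- S) i j" using disjoint reach_iff[of i j] sides by auto
  define g where "g = witness A i j"
  have "card A = card (A - {i, j}) + card {i, j}"
    using ij by (subst card_Un_disjoint[symmetric]) (auto intro: arg_cong[of _ _ card])
  then have cardA: "card A = 2 + card (A - {i, j})" using \<open>i \<noteq> j\<close> by simp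
  have hom: "homogeneous_of_degree (card A) g"
    unfolding g_def witness_def cardA by (intro homogeneous_mult homogeneous_fbinom homogeneous_prod_pvar)
  have "(\<Prod>a\<in>B. pvar (X a)) \<notin> comp_ideal G (- S)" if "B \<subseteq> A" for B
    using finite[of B] that A'(1)
    by (induction B rule: finite_induct)
      (auto simp: one_notin_segre_ideal segre_ideal_prime pvar_X_in_segre_ideal)
  then have notin: "g \<notin> comp_ideal G (- S)"
    using \<open>\<not> reach G (- S) i j\<close> ij A'(1)
    by (auto simp: g_def witness_def segre_ideal_prime fbinom_in_comp_ideal)
  have "cut_gens \<subseteq> ideal_colon (binomial_edge_ideal G) g"
  proof -
    \<comment> \<open>Exchanging the sides also exchanges \<open>i\<close> and \<open>j\<close>,
      which only changes the sign.\<close>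
    have neg: "witness A i j = - sw.witness A j i"
      by (simp add: witness_def sw.witness_def fbinom_swap[of i j] insert_commute)
    have "fbinom k l * g \<in> binomial_edge_ideal G" if "k \<in> V1 \<and> l \<in> V1 \<or> k \<in> V2 \<and> l \<in> V2" for k l
      using that
    proof
      assume "k \<in> V1 \<and> l \<in> V1"
      then show ?thesis using side_binomial_times_witness[OF A'(1,2) ij] by (simp add: g_def)
    next
      assume "k \<in> V2 \<and> l \<in> V2"
      then have "fbinom k l * sw.witness A j i \<in> binomial_edge_ideal G"
        using sw.side_binomial_times_witness[OF A'(1,3) ij(2,1)] by simp
      then show ?thesis using ideal_uminus[OF is_ideal_edge_ideal] by (simp add: g_def neg)
    qed
    moreover have "pvar (X s) * g \<in> binomial_edge_ideal G" "pvar (Y s) * g \<in> binomial_edge_ideal G"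
      if "s \<in> S" for s
      using cut_variable_times_witness[OF A ij that] by (simp_all add: g_def)
    ultimately show ?thesis by (auto simp: cut_gens_def ideal_colon_def)
  qed
  then have "comp_ideal G (- S) \<subseteq> ideal_colon (binomial_edge_ideal G) g"
    unfolding ideal_gen_cut_gens[symmetric]
    by (intro ideal_gen_subset is_ideal_colon is_ideal_edge_ideal)
  then show thesis using that[OF hom notin] by (auto simp: ideal_colon_def)
qed

text \<open>Ensures that the minimum in \<open>gamma_c\<close> is attained, and provides the witness
  that excludes \<open>f \<in> P\<^sub>S\<close> in the lower bound.\<close>

lemma conn_dominating_pairs_nonempty: "V1 \<union> V2 \<in> conn_dominating_pairs G S V1 V2"
proof -
  interpret sw: two_sided_cut G S V2 V1 by (rule swap)
  have 1: "V1 \<noteq> {}" "V2 \<noteq> {}" using S_nonempty nbr1 nbr2 by blast+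
  have "reach G V1 u v" if "u \<in> V1" "v \<in> V1" for u v
    using reach_stays[OF conn1[OF that] that(1)] sides by (auto intro: reach_mono[rotated])
  moreover have "reach G V2 u v" if "u \<in> V2" "v \<in> V2" for u v
    using sw.reach_stays[OF conn2[OF that] that(1)] sides by (auto intro: reach_mono[rotated])
  moreover have "(V1 \<union> V2) \<inter> V1 = V1" "(V1 \<union> V2) \<inter> V2 = V2" by auto
  ultimately show ?thesis
    using 1 nbr1 nbr2 conn_dominating_iff[of V1] sw.conn_dominating_iff[of V2]
    by (auto simp: conn_dominating_pairs_def)
qed

section \<open>Lower bound: connected domination from separation\<close>

lemma dominating_side:
  assumes A: "A \<subseteq> - S"
    and sep: "\<And>W p. A \<subseteq> W \<Longrightarrow> p \<in> comp_ideal G (- S) \<Longrightarrow> p \<notin> comp_ideal G W \<Longrightarrow>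
      \<exists>u\<in>A. \<exists>v\<in>A. reach G W u v \<and> \<not> reach G (- S) u v"
  shows "A \<inter> V1 \<in> conn_dominating_sets (induced_subgraph G (V1 \<union> S))"
proof -
  \<comment> \<open>A walk inside \<open>W \<subseteq> - S\<close> never changes sides, so
    \<open>sep\<close> leaves no element of \<open>P\<^sub>S\<close> outside
    \<open>Q\<^sub>W\<close>, in particular no \<open>fbinom u v\<close>.\<close>
  have inner: "reach G W u v" if "A \<subseteq> W" "W \<subseteq> - S" "u \<in> W \<inter> V1" "v \<in> W \<inter> V1" for W u v
  proof (rule ccontr)
    assume "\<not> reach G W u v"
    then have "fbinom u v \<notin> comp_ideal G W" "fbinom u v \<in> comp_ideal G (- S)"
      using that conn1 by (auto simp: fbinom_in_comp_ideal)
    then show False using sep[OF that(1)] reach_mono[OF that(2)] by blast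
  qed
  \<comment> \<open>The element \<open>x\<^sub>s\<close> yields a walk across the cut in
    \<open>A\<close> and \<open>s\<close>. Without an edge from \<open>s\<close> to
    \<open>A \<inter> V1\<close> such a walk could not leave or enter \<open>V1\<close>.\<close>
  have S_dom: "\<exists>b\<in>A \<inter> V1. adjacent G s b" if s: "s \<in> S" for s
  proof (rule ccontr)
    assume no: "\<not> ?thesis"
    have "pvar (X s) \<in> comp_ideal G (- S)" "pvar (X s) \<notin> comp_ideal G (insert s A)"
      using s by (auto simp: pvar_X_in_segre_ideal)
    from sep[OF _ this] obtain u v where uv: "u \<in> A" "v \<in> A" "reach G (insert s A) u v" "\<not> reach G (- S) u v"
      by blast
    have stay: "v \<in> V1" if "reach G (insert s A) u v" "u \<in> A \<inter> V1" for u v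
      using that
    proof (induction rule: rtranclp_induct)
      case (step v w)
      then have "adjacent G v w" "v \<in> insert s A" "w \<in> insert s A" "v \<in> V1"
        by (auto simp: adjacent_induced)
      moreover have "v \<noteq> s" using \<open>v \<in> V1\<close> s sides by auto
      moreover have "w \<noteq> s" using calculation no adjacent_sym[of G v w] by auto
      ultimately show ?case using no_edge A sides by blast
    qed simp
    have "u \<in> - S" "v \<in> - S" using uv(1,2) A by auto
    then show False
      using uv stay[OF uv(3)] stay[OF reach_sym[OF uv(3)]] reach_iff[of u v] by auto
  qed
  then obtain b where b: "b \<in> A \<inter> V1" using S_nonempty by blast
  \<comment> \<open>With \<open>W = insert v A\<close>, the first edge of a walk from
    \<open>v\<close> to \<open>b\<close> leads to a neighbour in
    \<open>A \<inter> V1\<close>.\<close>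
  have V_dom: "\<exists>b\<in>A \<inter> V1. adjacent G v b" if v: "v \<in> V1 - A" for v
  proof -
    have W: "insert v A \<subseteq> - S" using v A sides by auto
    have "reach G (insert v A) v b" using inner[of "insert v A" v b] W v b by auto
    then obtain w where "adjacent (induced_subgraph G (insert v A)) v w"
      using v b by (auto elim: converse_rtranclpE)
    then have "adjacent G v w" "w \<in> insert v A" by (auto simp: adjacent_induced)
    then show ?thesis using adjacent_neq[of v w] no_edge[of v w] v W sides by blast
  qed
  have "reach G (A \<inter> V1) u v" if "u \<in> A \<inter> V1" "v \<in> A \<inter> V1" for u v
    using reach_stays[OF inner[OF order.refl A that]] that A by auto
  then show ?thesis
    using b S_dom V_dom by (subst conn_dominating_iff) auto
qed

lemma dominating_of_colon:
  assumes f: "homogeneous_of_degree d f" "ideal_colon (binomial_edge_ideal G) f = comp_ideal G (- S)"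
  shows "\<exists>A\<in>conn_dominating_pairs G S V1 V2. card A \<le> d"
proof -
  interpret sw: two_sided_cut G S V2 V1 by (rule swap)
  have colon: "p \<in> comp_ideal G (- S) \<longleftrightarrow> p * f \<in> binomial_edge_ideal G" for p
    using f(2) by (auto simp: ideal_colon_def)
  have "f \<notin> comp_ideal G (- S)"
  proof
    assume "f \<in> comp_ideal G (- S)"
    obtain g where "g \<notin> comp_ideal G (- S)" "f * g \<in> binomial_edge_ideal G"
      using ex_witness[OF conn_dominating_pairs_nonempty] \<open>f \<in> _\<close> by metis
    then show False using colon[of g] by (simp add: mult.commute)
  qed
  \<comment> \<open>The exponent \<open>a\<close> is the multidegree of a graded component of
    \<open>f\<close> outside \<open>P\<^sub>S\<close>; its support is the desired set.\<close>
  then obtain a b where a: "keys a \<subseteq> - S"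
    and nz: "(\<Sum>m | m \<in> keys f \<and> xdeg m = a \<and> ydeg (comp_label G (- S)) m = b. lookup f m) \<noteq> 0"
    by (auto simp: segre_ideal_iff)
  from nz obtain m where m: "m \<in> keys f" "xdeg m = a"
    by (metis (mono_tags, lifting) mem_Collect_eq sum.neutral)
  have "mon_degree m = d" using f(1) m(1) by (simp add: homogeneous_of_degree_def)
  then have card: "card (keys a) \<le> d" using card_keys_xdeg_le[of m] m(2) by simp
  \<comment> \<open>Primality puts \<open>f\<close> into \<open>Q\<^sub>W\<close>. If no component
    of \<open>G\<^sub>W\<close> joined the two sides, its labels would refine those of
    \<open>- S\<close> on \<open>keys a\<close>, contradicting \<open>nz\<close>.\<close>
  have sep: "\<exists>u\<in>keys a. \<exists>v\<in>keys a. reach G W u v \<and> \<not> reach G (- S) u v"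
    if "keys a \<subseteq> W" "p \<in> comp_ideal G (- S)" "p \<notin> comp_ideal G W" for W p
  proof (rule ccontr)
    assume no: "\<not> ?thesis"
    have "p * f \<in> comp_ideal G W" using that(2) colon edge_ideal_subset_comp_ideal by blast
    then have "f \<in> comp_ideal G W" using that(3) segre_ideal_prime by blast
    moreover have "comp_label G (- S) u = comp_label G (- S) v"
      if "u \<in> keys a" "v \<in> keys a" "comp_label G W u = comp_label G W v" for u v
      using no that unfolding comp_label_eq_iff by blast
    ultimately show False
      using fiber_sum_zero_of_finer[of f W "comp_label G W" a "comp_label G (- S)" b] that(1) nz
      by blast
  qed
  have "keys a \<in> conn_dominating_pairs G S V1 V2"
    using a sides dominating_side[OF a sep] sw.dominating_side[OF a sep]
    by (auto simp: conn_dominating_pairs_def)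
  then show ?thesis using card by blast
qed

lemma v_number_comp_ideal:
  "v_number (comp_ideal G (- S)) (binomial_edge_ideal G) = enat (gamma_c G S V1 V2)"
proof -
  let ?D = "conn_dominating_pairs G S V1 V2"
  have fin: "finite (card ` ?D)" by simp
  have "gamma_c G S V1 V2 \<in> card ` ?D"
    unfolding gamma_c_def using conn_dominating_pairs_nonempty by (intro Min_in) auto
  then obtain A where A: "A \<in> ?D" "gamma_c G S V1 V2 = card A" by auto
  obtain g where g: "homogeneous_of_degree (card A) g" "g \<notin> comp_ideal G (- S)"
    "\<And>p. p \<in> comp_ideal G (- S) \<Longrightarrow> p * g \<in> binomial_edge_ideal G"
    using ex_witness[OF A(1)] by metis
  \<comment> \<open>One inclusion is \<open>g(3)\<close>; the other holds because the prime
    \<open>P\<^sub>S\<close> contains the edge ideal but not \<open>g\<close>.\<close>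
  have "ideal_colon (binomial_edge_ideal G) g = comp_ideal G (- S)"
  proof
    show "ideal_colon (binomial_edge_ideal G) g \<subseteq> comp_ideal G (- S)"
    proof
      fix p assume "p \<in> ideal_colon (binomial_edge_ideal G) g"
      then have "p * g \<in> comp_ideal G (- S)"
        using edge_ideal_subset_comp_ideal by (auto simp: ideal_colon_def)
      then show "p \<in> comp_ideal G (- S)" using g(2) segre_ideal_prime by blast
    qed
  qed (use g(3) in \<open>auto simp: ideal_colon_def\<close>)
  then have "v_number (comp_ideal G (- S)) (binomial_edge_ideal G) \<le> enat (gamma_c G S V1 V2)"
    unfolding v_number_def A(2) using g(1) by (intro Inf_lower) blast
  moreover have "enat (gamma_c G S V1 V2) \<le> v_number (comp_ideal G (- S)) (binomial_edge_ideal G)"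
    unfolding v_number_def
  proof (rule Inf_greatest, clarify)
    fix d f assume "homogeneous_of_degree d f" "ideal_colon (binomial_edge_ideal G) f = comp_ideal G (- S)"
    then obtain A where "A \<in> ?D" "card A \<le> d" using dominating_of_colon by blast
    then have "gamma_c G S V1 V2 \<le> d"
      unfolding gamma_c_def using Min_le[OF fin, of "card A"] by (meson image_eqI order.trans)
    then show "enat (gamma_c G S V1 V2) \<le> enat d" by simp
  qed
  ultimately show ?thesis by (rule antisym)
qed

end

section \<open>From minimal cuts to two-sided cuts\<close>

lemma conn_components_iff:
  "C \<in> conn_components H \<longleftrightarrow> (\<exists>u\<in>verts H. C = {v \<in> verts H. (adjacent H)\<^sup>*\<^sup>* u v})"
  by (auto simp: conn_components_def quotient_def)

lemma two_sided_cut_of_minimal_cut: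
  fixes G :: "('v::{finite,linorder}) ugraph"
  assumes G: "simple_graph G" "verts G = UNIV" "minimal_cut G S"
    and comps: "conn_components (induced_subgraph G (- S)) = {V1, V2}"
  shows "two_sided_cut G S V1 V2" and "V1 \<noteq> V2"
proof -
  have vH: "verts (induced_subgraph G W) = W" for W using G(2) by (simp add: verts_induced)
  have cut: "S \<noteq> {}" "card {V1, V2} = 2"
    "\<And>s. s \<in> S \<Longrightarrow> cut_point (induced_subgraph G (- S \<union> {s})) s"
    using G(2,3) comps by (auto simp: minimal_cut_def Compl_eq_Diff_UNIV)
  then show neq: "V1 \<noteq> V2" by auto
  have comp: "C \<in> {V1, V2} \<longleftrightarrow> (\<exists>u\<in>- S. C = {v \<in> - S. reach G (- S) u v})" for C
    unfolding comps[symmetric] conn_components_iff vH ..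
  have side: "C \<subseteq> - S \<and> C \<noteq> {}" if "C \<in> {V1, V2}" for C
  proof -
    obtain u where "u \<in> - S" "C = {v \<in> - S. reach G (- S) u v}" using comp \<open>C \<in> _\<close> by blast
    then show ?thesis by auto
  qed
  have V_sub: "V1 \<subseteq> - S" "V2 \<subseteq> - S" and ne: "V1 \<noteq> {}" "V2 \<noteq> {}"
    using side[of V1] side[of V2] by simp_all
  have V_eq: "C = {v \<in> - S. reach G (- S) u v}" if C: "C \<in> {V1, V2}" "u \<in> C" for C u
  proof -
    obtain x where x: "x \<in> - S" "C = {v \<in> - S. reach G (- S) x v}" using comp C(1) by blast
    then have "reach G (- S) x u" using C(2) by simp
    then have "reach G (- S) x v \<longleftrightarrow> reach G (- S) u v" for v
      by (meson reach_sym rtranclp_trans)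
    then show ?thesis using x(2) by simp
  qed
  have union: "V1 \<union> V2 = - S"
  proof
    show "- S \<subseteq> V1 \<union> V2"
    proof
      fix u assume u: "u \<in> - S"
      then have "{v \<in> - S. reach G (- S) u v} \<in> {V1, V2}" unfolding comp by blast
      moreover have "u \<in> {v \<in> - S. reach G (- S) u v}" using u by simp
      ultimately show "u \<in> V1 \<union> V2" by blast
    qed
  qed (use V_sub in simp)
  have mem: "v \<in> C \<longleftrightarrow> v \<in> - S \<and> reach G (- S) u v" if "C \<in> {V1, V2}" "u \<in> C" for C u v
    by (subst V_eq[OF that]) simp
  have disj: "V1 \<inter> V2 = {}"
  proof (rule ccontr)
    assume "V1 \<inter> V2 \<noteq> {}"
    then obtain u where "u \<in> V1" "u \<in> V2" by blast
    then have "V1 = V2" using V_eq[of V1 u] V_eq[of V2 u] by simp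
    then show False using neq by simp
  qed
  have conn: "reach G (- S) u v" if "C \<in> {V1, V2}" "u \<in> C" "v \<in> C" for C u v
    using mem[OF that(1,2)] that(3) by simp
  have no_edge: "\<not> adjacent G u v" if "u \<in> V1" "v \<in> V2" for u v
  proof
    assume "adjacent G u v"
    then have "reach G (- S) u v"
      using that V_sub by (intro r_into_rtranclp) (auto simp: adjacent_induced)
    then have "v \<in> V1" using mem[of V1 u v] that V_sub by auto
    then show False using that disj by auto
  qed
  \<comment> \<open>Restoring \<open>s\<close> leaves fewer than two components, so \<open>s\<close>
    is reachable from \<open>C\<close>. Without an edge from \<open>s\<close> to \<open>C\<close>,
    every walk starting in \<open>C\<close> would stay there.\<close>
  have nbr: "\<exists>v\<in>C. adjacent G s v" if s: "s \<in> S" and C: "C \<in> {V1, V2}" for s C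
  proof (rule ccontr)
    assume no: "\<not> ?thesis"
    let ?W = "- S \<union> {s}"
    have "?W \<inter> (?W - {s}) = - S" using s by auto
    then have "card (conn_components (induced_subgraph G ?W)) < 2"
      using cut(3)[OF s] comps cut(2) by (simp only: cut_point_def vH induced_induced)
    moreover have "finite (conn_components (induced_subgraph G ?W))" by simp
    ultimately have one: "C = C'" if "C \<in> conn_components (induced_subgraph G ?W)"
        "C' \<in> conn_components (induced_subgraph G ?W)" for C C'
      using that card_le_Suc0_iff_eq[of "conn_components (induced_subgraph G ?W)"] by auto
    obtain u where u: "u \<in> C" using C ne by auto
    have "{v \<in> ?W. reach G ?W u v} = {v \<in> ?W. reach G ?W s v}"
      using u C V_sub by (intro one) (auto simp: conn_components_iff vH)
    then have "reach G ?W u s" by auto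
    then have "s \<in> C"
    proof (induction rule: rtranclp_induct)
      case (step v w)
      then have vw: "adjacent G v w" "w \<in> ?W" "v \<in> C" by (auto simp: adjacent_induced)
      then have "w \<noteq> s" using no adjacent_sym[of G v w] by auto
      then show ?case using vw C no_edge[of v w] no_edge[of w v] adjacent_sym[of G v w] union by blast
    qed (rule u)
    then show False using C V_sub s by auto
  qed
  show "two_sided_cut G S V1 V2"
    using G(1,2) cut(1) union disj conn[of V1] conn[of V2] no_edge nbr[of _ V1] nbr[of _ V2]
    by unfold_locales auto
qed

text \<open>As \<open>V1 \<noteq> V2\<close>, the sum over components has exactly one summand per
  side, and \<open>ideal_gen_Un\<close> merges all summands.\<close>

lemma cut_ideal_eq:
  assumes cut: "two_sided_cut G S V1 V2" and G: "verts G = UNIV"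
    and comps: "conn_components (induced_subgraph G (- S)) = {V1, V2}" and "V1 \<noteq> V2"
  shows "cut_ideal G S = comp_ideal G (- S)"
proof -
  interpret two_sided_cut G S V1 V2 by (rule cut)
  have "cut_ideal G S = ideal_gen cut_gens"
    using comps \<open>V1 \<noteq> V2\<close>
    by (simp add: cut_ideal_def G Compl_eq_Diff_UNIV[symmetric] cut_gens_def ideal_gen_Un)
  then show ?thesis by (simp add: ideal_gen_cut_gens)
qed

theorem theorem1:
  fixes G :: "('v::{finite,linorder}) ugraph" and S V1 V2 :: "'v set"
  assumes "simple_graph G" and "verts G = UNIV" and "connected_graph G"
    and "minimal_cut G S"
    and "conn_components (induced_subgraph G (UNIV - S)) = {V1, V2}"
  shows "v_number (cut_ideal G S) (binomial_edge_ideal G) = enat (gamma_c G S V1 V2) \<and>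
    gamma_c G S V1 V2 = Min {card A | A. A \<in> conn_dominating_pairs G S V1 V2}"
proof
  have comps: "conn_components (induced_subgraph G (- S)) = {V1, V2}"
    using assms(5) by (simp add: Compl_eq_Diff_UNIV)
  note cut = two_sided_cut_of_minimal_cut[OF assms(1,2,4) comps]
  show "v_number (cut_ideal G S) (binomial_edge_ideal G) = enat (gamma_c G S V1 V2)"
    using two_sided_cut.v_number_comp_ideal[OF cut(1)] cut_ideal_eq[OF cut(1) assms(2) comps cut(2)]
    by simp
  show "gamma_c G S V1 V2 = Min {card A | A. A \<in> conn_dominating_pairs G S V1 V2}"
    by (simp add: gamma_c_def setcompr_eq_image)
qed

end
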